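(* Let $M_j(x)\in\mathbb{Q}[x]$ ($j\ge0$) be the polynomials with generating series $$\sum_{j \geq 0} M_{j}(x) q^j = \frac{(1-q)^2(1-q^2)}{\prod_{n\ge1}(1-q^n)^3}\left(\binom{x+2}{2} - 3 \sum_{i\geq 1} \frac{q^{i}}{(1- q^{i})^2}\right),$$ and for $\delta\ge0$ let $$n_\delta(x)= \sum_{j=0}^\delta M_j(x) \binom{x^2-3x+3-\delta-j}{\delta-j}.$$ Let $t$ and $q$ be related by $$t = \frac{q}{(1-q)^2}, \qquad q = \frac{1+2t-\sqrt{1+4t}}{2t}.$$ Then $$\sum_{\delta \geq 0} n_\delta(x) t^\delta = \frac{1}{(1-q)^{x^2-3x+2}(1-q^2)} \sum_{j \geq 0} M_j(x) q^j$$ and $$\sum_{\delta \geq 0} n_\delta(x) t^\delta = \frac{1}{(1-q)^{x^2-3x} \prod_{n\ge1}(1-q^n)^3} \left(\binom{x+2}{2} - 3 \sum_{i\geq 1} \frac{q^i}{(1- q^i)^2} \right).$$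
   Context: Identities are between formal power series (in $t$, or equivalently in $q$) with coefficients in $\mathbb{Q}[x]$. For a polynomial $a$ and integer $k\ge 0$, $\binom{a}{k}=a(a-1)\cdots(a-k+1)/k!$, and $(1-q)^{p(x)}$ is expanded by the binomial series. (Meaning of $n_\delta$: for integers $d\ge\delta+2$, $n_\delta(d)=(-1)^{g(d)+d-1-\delta}n^{g(d)-\delta}_d$ with $g(d)=(d-1)(d-2)/2$, where $n^g_d$ are the Gopakumar-Vafa invariants of the total space of $\mathcal{O}_{\mathbb{P}^2}(-3)$.) *)

theory Defs
  imports "HOL-Analysis.Analysis" "HOL-Computational_Algebra.Computational_Algebra"
begin

text \<open>
  All series live in the ring \<open>\<rat>[x][[z]]\<close>, that is, in \<open>rat poly fps\<close>, whose single variable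
  \<open>fps_X\<close> is read as \<open>q\<close> or as \<open>t\<close>. Infinite sums and products are limits in the \<open>z\<close>-adic metric
  with which the library equips \<open>fps\<close>.
\<close>

abbreviation xvar :: "rat poly" where "xvar \<equiv> [:0, 1:]"

text \<open>
  The type \<open>rat poly\<close> has no \<open>inverse\<close>, so the library's division of power series is not available.
  As \<open>\<rat>[x][[z]]\<close> is an integral domain, a quotient by a nonzero series is unique if it exists
  (and the value is unspecified if it does not).
\<close>

definition fps_quot :: "rat poly fps \<Rightarrow> rat poly fps \<Rightarrow> rat poly fps"  (infixl \<open>\<oslash>\<close> 70)
  where "f \<oslash> g = (THE h. h * g = f)"

lemma fps_quot_eqI:
  assumes "g \<noteq> 0" "h * g = f"
  shows "f \<oslash> g = h"
  unfolding fps_quot_def using assms by (intro the_equality) auto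

lemma fps_quot_mult_cancel:
  assumes "fps_nth g 0 = 1"
  shows "(f \<oslash> g) * g = f"
proof -
  have "fps_left_inverse g 1 * g = 1"
    by (rule fps_left_inverse) (simp add: assms)
  then have *: "(f * fps_left_inverse g 1) * g = f"
    by (simp add: mult.assoc)
  moreover have "g \<noteq> 0" using assms by auto
  ultimately show ?thesis using fps_quot_eqI by metis
qed

text \<open>
  The library restricts \<open>gchoose\<close> to fields of characteristic \<open>0\<close>, so it does not apply to polynomials.
\<close>

definition poly_choose :: "rat poly \<Rightarrow> nat \<Rightarrow> rat poly"  (infix \<open>pchoose\<close> 64)
  where "a pchoose k = smult (1 / fact k) (\<Prod>i<k. a - of_nat i)"

lemma poly_pchoose: "poly (a pchoose k) r = poly a r gchoose k"
  by (simp add: poly_choose_def poly_prod gbinomial_prod_rev atLeast0LessThan)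

text \<open>
  The binomial series \<open>(1 + u)\<^sup>a\<close>, for \<open>u\<close> with vanishing constant term. (The library's
  \<open>fps_binomial\<close> is restricted to fields.)
\<close>

definition binom_pow :: "rat poly fps \<Rightarrow> rat poly \<Rightarrow> rat poly fps"
  where "binom_pow u a = fps_compose (Abs_fps (\<lambda>k. a pchoose k)) u"

definition t_of_q :: "rat poly fps"
  where "t_of_q = fps_X \<oslash> (1 - fps_X)^2"

text \<open>The square root is the branch with constant term \<open>1\<close>.\<close>

definition q_of_t :: "rat poly fps"
  where "q_of_t = (1 + 2 * fps_X - binom_pow (4 * fps_X) [:1/2:]) \<oslash> (2 * fps_X)"

definition eta_prod :: "rat poly fps"  \<comment> \<open>\<open>\<Prod>\<^bsub>n\<ge>1\<^esub> (1 - q\<^sup>n)\<^sup>3\<close>\<close>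
  where "eta_prod = (\<Prod>n. (1 - fps_X ^ Suc n) ^ 3)"

definition lambert_sum :: "rat poly fps"  \<comment> \<open>\<open>\<Sum>\<^bsub>i\<ge>1\<^esub> q\<^sup>i / (1 - q\<^sup>i)\<^sup>2\<close>\<close>
  where "lambert_sum = (\<Sum>i. fps_X ^ Suc i \<oslash> (1 - fps_X ^ Suc i)^2)"

end

theory Submission
  imports Defs
begin

text \<open>
  With \<open>S\<^sub>b = \<Sum>\<^sub>k (b - k choose k) t\<^sup>k\<close>, the series of the \<open>n\<^sub>\<delta>\<close> is \<open>\<Sum>\<^sub>j M\<^sub>j t\<^sup>j S\<^bsub>a-2j\<^esub>\<close> for
  \<open>a = x\<^sup>2 - 3x + 3\<close>, so everything reduces to \<open>S\<^sub>b(t) = (1 - q)\<^bsup>-b\<^esup> / (1 + q)\<close>. For a natural number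
  \<open>b = N\<close>, \<open>S\<^sub>N\<close> agrees up to degree \<open>N\<close> with the \<open>N\<close>-th Fibonacci polynomial, for which the recurrence
  \<open>f\<^bsub>N+2\<^esub> = f\<^bsub>N+1\<^esub> + t f\<^sub>N\<close> gives \<open>f\<^sub>N(t) (1 - q)\<^sup>N (1 + q) = 1 - (-q)\<^bsup>N+1\<^esup>\<close>. Hence every coefficient of
  \<open>S\<^sub>b(t) (1 - q)\<^sup>b (1 + q) - 1\<close> is a polynomial in \<open>b\<close> that vanishes at all large natural numbers.
\<close>

subsection \<open>Evaluation of the coefficients\<close>

definition eval_fps_coeffs :: "'a::comm_ring_1 \<Rightarrow> 'a poly fps \<Rightarrow> 'a fps"
  where "eval_fps_coeffs r f = Abs_fps (\<lambda>k. poly (fps_nth f k) r)"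

lemma eval_fps_coeffs_nth [simp]: "fps_nth (eval_fps_coeffs r f) k = poly (fps_nth f k) r"
  by (simp add: eval_fps_coeffs_def)

lemma eval_fps_coeffs_simps [simp]:
  "eval_fps_coeffs r 0 = 0" "eval_fps_coeffs r 1 = 1" "eval_fps_coeffs r fps_X = fps_X"
  "eval_fps_coeffs r (f + g) = eval_fps_coeffs r f + eval_fps_coeffs r g"
  "eval_fps_coeffs r (f - g) = eval_fps_coeffs r f - eval_fps_coeffs r g"
  "eval_fps_coeffs r (- f) = - eval_fps_coeffs r f"
  by (auto simp: fps_eq_iff fps_X_def)

lemma eval_fps_coeffs_mult [simp]:
  "eval_fps_coeffs r (f * g) = eval_fps_coeffs r f * eval_fps_coeffs r g"
  by (simp add: fps_eq_iff fps_mult_nth poly_sum)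

lemma eval_fps_coeffs_power [simp]: "eval_fps_coeffs r (f ^ n) = eval_fps_coeffs r f ^ n"
  by (induction n) auto

lemma eval_fps_coeffs_compose [simp]:
  "eval_fps_coeffs r (f oo g) = eval_fps_coeffs r f oo eval_fps_coeffs r g"
  by (simp add: fps_eq_iff fps_compose_nth poly_sum flip: eval_fps_coeffs_power)

text \<open>A polynomial over an infinite domain is determined by its values. Binomial identities
  over \<open>rat poly\<close> thus reduce to those for \<open>fps_binomial\<close> over
  \<open>rat\<close>.\<close>

lemma fps_eqI_eval_coeffs:
  fixes f g :: "'a::{idom, ring_char_0} poly fps"
  assumes "\<And>r. eval_fps_coeffs r f = eval_fps_coeffs r g"
  shows "f = g"
proof (rule fps_ext)
  fix k
  have "poly (fps_nth f k) r = poly (fps_nth g k) r" for r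
    using arg_cong[OF assms[of r], of "\<lambda>h. fps_nth h k"] by simp
  then show "fps_nth f k = fps_nth g k"
    by (auto simp flip: poly_eq_poly_eq_iff)
qed

lemma poly_eq_if_eq_at_large_nats:
  fixes p q :: "'a::{idom, ring_char_0} poly"
  assumes "\<And>N. N \<ge> k \<Longrightarrow> poly p (of_nat N) = poly q (of_nat N)"
  shows "p = q"
proof (rule ccontr)
  assume "p \<noteq> q"
  then have "finite {x. poly (p - q) x = 0}"
    by (intro poly_roots_finite) simp
  moreover have "of_nat ` {k..} \<subseteq> {x. poly (p - q) x = 0}"
    using assms by auto
  ultimately have "finite ((of_nat :: nat \<Rightarrow> 'a) ` {k..})"
    using finite_subset by blast
  then show False
    by (simp add: finite_image_iff inj_on_def infinite_Ici)
qed

subsection \<open>Binomial powers\<close>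

lemma eval_fps_coeffs_binom_pow [simp]:
  "eval_fps_coeffs r (binom_pow u a) = fps_binomial (poly a r) oo eval_fps_coeffs r u"
proof -
  have "eval_fps_coeffs r (Abs_fps (\<lambda>k. a pchoose k)) = fps_binomial (poly a r)"
    by (simp add: fps_eq_iff poly_pchoose)
  then show ?thesis
    by (simp add: binom_pow_def)
qed

lemma binom_pow_nth_0 [simp]: "fps_nth (binom_pow u a) 0 = 1"
  by (simp add: binom_pow_def poly_choose_def)

lemma binom_pow_add:
  assumes "fps_nth u 0 = 0"
  shows "binom_pow u (a + b) = binom_pow u a * binom_pow u b"
  by (rule fps_eqI_eval_coeffs) (simp add: assms fps_binomial_add_mult fps_compose_mult_distrib)

lemma binom_pow_of_nat:
  assumes "fps_nth u 0 = 0"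
  shows "binom_pow u (of_nat k) = (1 + u) ^ k"
  by (rule fps_eqI_eval_coeffs)
    (simp add: assms fps_binomial_of_nat fps_compose_add_distrib flip: fps_compose_power)

subsection \<open>The change of variables\<close>

lemma t_of_q_mult: "t_of_q * (1 - fps_X)^2 = fps_X"
  unfolding t_of_q_def by (rule fps_quot_mult_cancel) (simp add: startsby_one_power)

lemma t_of_q_nth_0 [simp]: "fps_nth t_of_q 0 = 0"
  using arg_cong[OF t_of_q_mult, of "\<lambda>f. fps_nth f 0"] by simp

lemma q_of_t_quadratic: "fps_X * (1 - q_of_t)^2 = q_of_t"
  and q_of_t_nth_0 [simp]: "fps_nth q_of_t 0 = 0"
proof -
  define s where "s = binom_pow (4 * fps_X) [:1/2:]"
  have "s * s = binom_pow (4 * fps_X) (of_nat 1)"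
    unfolding s_def by (subst binom_pow_add [symmetric]) (auto simp: one_pCons)
  then have s: "s * s = 1 + 4 * fps_X"
    by (subst (asm) binom_pow_of_nat) auto
  have s0: "fps_nth s 0 = 1"
    by (simp add: s_def)
  have "fps_nth (s * s) 1 = fps_nth (1 + 4 * fps_X :: rat poly fps) 1"
    by (simp only: s)
  then have s1: "fps_nth s 1 = 2"
    by (simp add: fps_mult_nth s0 numeral_fps_const)
  \<comment> \<open>The numerator has constant term 0, so dividing by \<open>2 * fps_X\<close> is a
    shift followed by halving.\<close>
  define h where "h = fps_const [:1/2:] * fps_shift 1 (1 + 2 * fps_X - s)"
  have half: "2 * fps_const [:1/2:] = (1 :: rat poly fps)"
    by (simp add: numeral_fps_const numeral_poly one_pCons flip: fps_const_1_eq_1)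
  have "fps_shift 1 (1 + 2 * fps_X - s) * fps_X = 1 + 2 * fps_X - s"
    by (auto simp: fps_eq_iff s0)
  moreover have "h * (2 * fps_X) = (2 * fps_const [:1/2:]) * (fps_shift 1 (1 + 2 * fps_X - s) * fps_X)"
    unfolding h_def by (simp only: mult_ac)
  ultimately have h: "h * (2 * fps_X) = 1 + 2 * fps_X - s"
    by (simp only: half mult_1_left)
  then have q: "q_of_t = h"
    unfolding q_of_t_def s_def[symmetric] by (intro fps_quot_eqI) auto
  have s_eq: "s = 1 + 2 * fps_X - 2 * fps_X * h"
    using h by (simp add: algebra_simps)
  \<comment> \<open>This is \<open>s * s - (1 + 4 * fps_X)\<close> with
    \<open>s = 1 + 2 * fps_X * (1 - h)\<close> inserted.\<close>
  have "4 * fps_X * (fps_X * (1 - h)^2 - h) = 0"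
    using s unfolding s_eq by (simp add: power2_eq_square algebra_simps)
  then show "fps_X * (1 - q_of_t)^2 = q_of_t"
    by (simp add: q)
  from arg_cong[OF this, of "\<lambda>f. fps_nth f 0"] show "fps_nth q_of_t 0 = 0"
    by simp
qed

lemma t_of_q_compose_q_of_t: "t_of_q oo q_of_t = fps_X"
proof -
  have "(t_of_q * (1 - fps_X)^2) oo q_of_t = fps_X oo q_of_t"
    by (simp only: t_of_q_mult)
  then have "(t_of_q oo q_of_t) * (1 - q_of_t)^2 = fps_X * (1 - q_of_t)^2"
    by (simp add: fps_compose_mult_distrib fps_compose_sub_distrib q_of_t_quadratic
        flip: fps_compose_power)
  moreover have "(1 - q_of_t)^2 \<noteq> 0"
    using q_of_t_nth_0 by (metis diff_zero fps_one_nth fps_sub_nth fps_zero_nth nat_less_le power_not_zero zero_neq_one)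
  ultimately show ?thesis
    by simp
qed

text \<open>Both sides solve \<open>t_of_q * (1 - w)^2 = w\<close>. Two solutions coincide: their
  difference is annihilated by a series with constant term 1.\<close>

lemma q_of_t_compose_t_of_q: "q_of_t oo t_of_q = fps_X"
proof -
  define w where "w = q_of_t oo t_of_q"
  have "(fps_X * (1 - q_of_t)^2) oo t_of_q = q_of_t oo t_of_q"
    by (simp only: q_of_t_quadratic)
  then have w: "t_of_q * (1 - w)^2 = w"
    by (simp add: w_def fps_compose_mult_distrib fps_compose_sub_distrib flip: fps_compose_power)
  have "w - fps_X = t_of_q * (1 - w)^2 - t_of_q * (1 - fps_X)^2"
    by (simp only: w t_of_q_mult)
  then have "(w - fps_X) * (1 + t_of_q * (2 - w - fps_X)) = 0"
    by (simp add: algebra_simps power2_eq_square)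
  moreover have "fps_nth (1 + t_of_q * (2 - w - fps_X)) 0 = 1"
    by simp
  then have "1 + t_of_q * (2 - w - fps_X) \<noteq> 0"
    by (metis fps_zero_nth zero_neq_one)
  ultimately show ?thesis
    by (simp add: w_def)
qed

subsection \<open>The diagonal binomial series\<close>

text \<open>Truncated subtraction makes the coefficients with \<open>k > N\<close> vanish (for
  \<open>N = 0\<close> as well), whereas the generalized binomial coefficient of the negative number
  \<open>N - k\<close> would not.\<close>

definition fib_fps :: "nat \<Rightarrow> 'a::comm_ring_1 fps"
  where "fib_fps N = Abs_fps (\<lambda>k. of_nat ((N - k) choose k))"

text \<open>Pascal's rule; in the degrees where the subtraction truncates, all three terms are
  0.\<close>

lemma fib_fps_rec: "fib_fps (Suc (Suc N)) = fib_fps (Suc N) + fps_X * fib_fps N"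
proof (rule fps_ext)
  fix k
  show "fps_nth (fib_fps (Suc (Suc N))) k
    = fps_nth (fib_fps (Suc N) + fps_X * fib_fps N :: 'a fps) k"
  proof (cases k)
    case (Suc l)
    then show ?thesis
      by (cases "l \<le> N") (auto simp: fib_fps_def Suc_diff_le binomial_eq_0)
  qed (simp add: fib_fps_def)
qed

text \<open>This is Binet's formula with denominators cleared: for \<open>t = q / (1 - q)^2\<close>
  the characteristic equation \<open>y^2 = y + t\<close> has the roots \<open>1 / (1 - q)\<close>
  and \<open>- q / (1 - q)\<close>.\<close>

lemma fib_fps_compose:
  fixes t :: "'a::idom fps"
  assumes t: "t * (1 - fps_X)^2 = fps_X"
  shows "(fib_fps N oo t) * (1 - fps_X)^N * (1 + fps_X) = 1 - (- fps_X) ^ Suc N"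
proof (induction N rule: induct_nat_012)
  case 0
  have "fib_fps 0 = (1 :: 'a fps)"
    by (auto simp: fib_fps_def fps_eq_iff binomial_eq_0)
  then show ?case by simp
next
  case 1
  have "fib_fps (Suc 0) = (1 :: 'a fps)"
    by (auto simp: fib_fps_def fps_eq_iff binomial_eq_0)
  then show ?case by (simp add: algebra_simps)
next
  case (ge2 N)
  have t0: "fps_nth t 0 = 0"
    using arg_cong[OF t, of "\<lambda>f. fps_nth f 0"] by simp
  let ?f = "\<lambda>N. (fib_fps N oo t) * (1 - fps_X)^N * (1 + fps_X)"
  have "?f (Suc (Suc N)) = (1 - fps_X) * ?f (Suc N) + (t * (1 - fps_X)^2) * ?f N"
    by (simp add: fib_fps_rec fps_compose_add_distrib fps_compose_mult_distrib t0
        algebra_simps power2_eq_square)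
  also have "\<dots> = 1 - (- fps_X) ^ Suc (Suc (Suc N))"
    unfolding t ge2.IH by (simp add: algebra_simps)
  finally show ?case .
qed

definition diag_binom_fps :: "rat poly \<Rightarrow> rat poly fps"
  where "diag_binom_fps b = Abs_fps (\<lambda>k. (b - of_nat k) pchoose k)"

lemma eval_fps_coeffs_diag_binom_nth [simp]:
  "fps_nth (eval_fps_coeffs r (diag_binom_fps b)) k = (poly b r - of_nat k) gchoose k"
  by (simp add: diag_binom_fps_def poly_pchoose)

lemma diag_binom_fps_compose_xvar:
  "(diag_binom_fps xvar oo t_of_q) * binom_pow (- fps_X) xvar * (1 + fps_X) = 1" (is "?L = 1")
proof (rule fps_ext)
  fix k
  show "fps_nth ?L k = fps_nth 1 k"
  proof (rule poly_eq_if_eq_at_large_nats[of k])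
    fix N assume N: "k \<le> N"
    let ?r = "of_nat N :: rat"
    define T where "T = eval_fps_coeffs ?r t_of_q"
    have T: "T * (1 - fps_X)^2 = fps_X"
      using arg_cong[OF t_of_q_mult, of "eval_fps_coeffs ?r"] by (simp add: T_def)
    have "fps_nth (eval_fps_coeffs ?r (diag_binom_fps xvar)) i = fps_nth (fib_fps N) i" if "i \<le> N" for i
      using that by (simp add: fib_fps_def binomial_gbinomial of_nat_diff del: eval_fps_coeffs_nth)
    \<comment> \<open>Coefficient \<open>i\<close> of a composition involves only the outer
      coefficients up to \<open>i\<close>, so agreement up to degree \<open>N\<close>
      survives.\<close>
    then have "fps_nth (eval_fps_coeffs ?r (diag_binom_fps xvar) oo T) i = fps_nth (fib_fps N oo T) i"
      if "i \<le> N" for i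
      using that by (simp add: fps_compose_nth del: eval_fps_coeffs_nth eval_fps_coeffs_diag_binom_nth)
    then have *: "fps_nth ((eval_fps_coeffs ?r (diag_binom_fps xvar) oo T) * g) k
      = fps_nth ((fib_fps N oo T) * g) k" for g
      using N unfolding fps_mult_nth by (intro sum.cong) auto
    have binom: "fps_binomial ?r oo - fps_X = (1 - fps_X) ^ N"
      by (simp add: fps_binomial_of_nat fps_compose_add_distrib flip: fps_compose_power)
    have "poly (fps_nth ?L k) ?r = fps_nth (eval_fps_coeffs ?r ?L) k"
      by (simp only: eval_fps_coeffs_nth)
    also have "\<dots> = fps_nth ((eval_fps_coeffs ?r (diag_binom_fps xvar) oo T)
        * ((1 - fps_X) ^ N * (1 + fps_X))) k"
      by (simp add: T_def binom mult.assoc del: eval_fps_coeffs_nth)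
    also have "\<dots> = fps_nth ((fib_fps N oo T) * ((1 - fps_X) ^ N * (1 + fps_X))) k"
      by (rule *)
    also have "\<dots> = fps_nth (1 - (- fps_X) ^ Suc N :: rat fps) k"
      using fib_fps_compose[OF T, of N] by (simp only: mult.assoc)
    also have "\<dots> = fps_nth 1 k"
      using N by (simp add: startsby_zero_power_prefix[rule_format] del: power_Suc)
    finally show "poly (fps_nth ?L k) ?r = poly (fps_nth 1 k) ?r"
      by simp
  qed
qed

text \<open>The defining relation of \<open>t_of_q\<close> does not involve \<open>x\<close>. This
  is what permits replacing \<open>x\<close> by a polynomial \<open>b\<close> in the identity for
  \<open>xvar\<close> without changing \<open>t_of_q\<close>.\<close>

lemma eval_fps_coeffs_t_of_q: "eval_fps_coeffs r t_of_q = eval_fps_coeffs s t_of_q"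
proof -
  have "eval_fps_coeffs u t_of_q * (1 - fps_X)^2 = fps_X" for u
    using arg_cong[OF t_of_q_mult, of "eval_fps_coeffs u"] by simp
  moreover have "(1 - fps_X :: rat fps)^2 \<noteq> 0"
    by (metis fps_X_nth diff_zero fps_one_nth fps_sub_nth power_not_zero zero_neq_one fps_zero_nth)
  ultimately show ?thesis
    by (metis mult_right_cancel)
qed

lemma diag_binom_fps_compose:
  "(diag_binom_fps b oo t_of_q) * binom_pow (- fps_X) b * (1 + fps_X) = 1"
proof (rule fps_eqI_eval_coeffs)
  fix r
  have "eval_fps_coeffs r (diag_binom_fps b) = eval_fps_coeffs (poly b r) (diag_binom_fps xvar)"
    by (simp add: fps_eq_iff del: eval_fps_coeffs_nth)
  moreover have "eval_fps_coeffs (poly b r)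
      ((diag_binom_fps xvar oo t_of_q) * binom_pow (- fps_X) xvar * (1 + fps_X)) = 1"
    by (simp only: diag_binom_fps_compose_xvar eval_fps_coeffs_simps)
  ultimately show "eval_fps_coeffs r
      ((diag_binom_fps b oo t_of_q) * binom_pow (- fps_X) b * (1 + fps_X)) = eval_fps_coeffs r 1"
    by (simp add: eval_fps_coeffs_t_of_q[of r "poly b r"])
qed

section \<open>Summation of the diagonal series against the coefficients \<open>M\<close>\<close>

lemma t_of_q_power_mult_diag_binom_fps:
  "t_of_q ^ j * (diag_binom_fps (a - 2 * of_nat j) oo t_of_q) * (binom_pow (- fps_X) a * (1 + fps_X))
    = fps_X ^ j"
proof -
  let ?c = "a - 2 * of_nat j"
  \<comment> \<open>Raising the exponent from \<open>?c\<close> to \<open>a\<close> supplies the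
    factor \<open>(1 - fps_X) ^ (2 * j)\<close> that turns \<open>t_of_q ^ j\<close> into
    \<open>fps_X ^ j\<close>.\<close>
  have "binom_pow (- fps_X) a = binom_pow (- fps_X) (?c + of_nat (2 * j))"
    by simp
  also have "\<dots> = binom_pow (- fps_X) ?c * (1 - fps_X) ^ (2 * j)"
    using binom_pow_add[of "- fps_X" ?c "of_nat (2 * j)"] binom_pow_of_nat[of "- fps_X" "2 * j"]
    by simp
  finally have "binom_pow (- fps_X) a = binom_pow (- fps_X) ?c * ((1 - fps_X)^2) ^ j"
    by (simp only: power_mult)
  then have "t_of_q ^ j * (diag_binom_fps ?c oo t_of_q) * (binom_pow (- fps_X) a * (1 + fps_X))
    = (t_of_q * (1 - fps_X)^2) ^ j * ((diag_binom_fps ?c oo t_of_q) * binom_pow (- fps_X) ?c * (1 + fps_X))"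
    by (simp only: power_mult_distrib mult_ac)
  then show ?thesis
    by (simp only: t_of_q_mult diag_binom_fps_compose mult_1_right)
qed

lemma compose_t_of_q_mult:
  fixes M n :: "nat \<Rightarrow> rat poly"
  assumes n: "\<And>\<delta>. n \<delta> = (\<Sum>j=0..\<delta>. M j * ((a - of_nat \<delta> - of_nat j) pchoose (\<delta> - j)))"
    and R: "R * (binom_pow (- fps_X) a * (1 + fps_X)) = 1"
  shows "Abs_fps n oo t_of_q = R * Abs_fps M"
proof (rule fps_ext)
  fix m
  let ?S = "\<lambda>j. diag_binom_fps (a - 2 * of_nat j)"
  \<comment> \<open>Only the terms with \<open>j \<le> m\<close> reach degree \<open>m\<close>, so a
    finite sum suffices and composition distributes over it.\<close>
  define P where "P = (\<Sum>j\<le>m. fps_const (M j) * (fps_X ^ j * ?S j))"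
  have "n \<delta> = fps_nth P \<delta>" if "\<delta> \<le> m" for \<delta>
  proof -
    have "fps_nth P \<delta> = (\<Sum>j\<le>m. if j \<le> \<delta> then M j * fps_nth (?S j) (\<delta> - j) else 0)"
      unfolding P_def fps_sum_nth by (intro sum.cong) (auto simp: fps_X_power_mult_nth)
    also have "\<dots> = (\<Sum>j=0..\<delta>. M j * fps_nth (?S j) (\<delta> - j))"
      using that by (intro sum.mono_neutral_cong_right) auto
    \<comment> \<open>The upper entries match because
      \<open>a - 2 * j - (\<delta> - j) = a - \<delta> - j\<close>.\<close>
    also have "\<dots> = n \<delta>"
      unfolding n diag_binom_fps_def by (intro sum.cong) (auto simp: of_nat_diff algebra_simps)
    finally show ?thesis ..
  qed
  then have "fps_nth (Abs_fps n oo t_of_q) m = fps_nth (P oo t_of_q) m"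
    by (simp add: fps_compose_nth)
  also have "P oo t_of_q = (\<Sum>j\<le>m. fps_const (M j) * (t_of_q ^ j * (?S j oo t_of_q)))"
    by (simp add: P_def fps_compose_sum_distrib fps_compose_mult_distrib flip: fps_compose_power)
  also have "\<dots> = (\<Sum>j\<le>m. fps_const (M j) * (fps_X ^ j * R))"
  proof (intro sum.cong refl)
    fix j
    have "t_of_q ^ j * (?S j oo t_of_q)
      = t_of_q ^ j * (?S j oo t_of_q) * (R * (binom_pow (- fps_X) a * (1 + fps_X)))"
      by (simp only: R mult_1_right)
    also have "\<dots> = (t_of_q ^ j * (?S j oo t_of_q) * (binom_pow (- fps_X) a * (1 + fps_X))) * R"
      by (simp only: mult_ac)
    also have "\<dots> = fps_X ^ j * R"
      by (simp only: t_of_q_power_mult_diag_binom_fps)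
    finally show "fps_const (M j) * (t_of_q ^ j * (?S j oo t_of_q)) = fps_const (M j) * (fps_X ^ j * R)"
      by simp
  qed
  also have "fps_nth \<dots> m = (\<Sum>j\<le>m. M j * fps_nth R (m - j))"
    unfolding fps_sum_nth by (intro sum.cong) (auto simp: fps_X_power_mult_nth)
  also have "\<dots> = fps_nth (R * Abs_fps M) m"
    by (subst mult.commute) (simp add: fps_mult_nth atLeast0AtMost)
  finally show "fps_nth (Abs_fps n oo t_of_q) m = fps_nth (R * Abs_fps M) m" .
qed

subsection \<open>The infinite product\<close>

text \<open>
  Convergence has to be checked: \<^const>\<open>prodinf\<close> is unspecified for divergent products.
\<close>

lemma eta_prod_nth_0 [simp]: "fps_nth eta_prod 0 = 1"
proof -
  define f :: "nat \<Rightarrow> rat poly fps" where "f = (\<lambda>n. (1 - fps_X ^ Suc n) ^ 3)"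
  define P where "P = (\<lambda>N. \<Prod>i\<le>N. f i)"
  define p where "p = Abs_fps (\<lambda>k. fps_nth (P k) k)"
  \<comment> \<open>The new factor is 1 modulo \<open>fps_X ^ (N + 2)\<close>, so low coefficients
    stabilize and \<open>p\<close> collects their final values.\<close>
  have step: "fps_nth (P (Suc N)) k = fps_nth (P N) k" if "k \<le> N" for k N
  proof -
    obtain h where h: "f (Suc N) = 1 + fps_X ^ Suc (Suc N) * h"
    proof
      let ?y = "fps_X ^ Suc (Suc N) :: rat poly fps"
      show "f (Suc N) = 1 + ?y * (- 3 + 3 * ?y - ?y^2)"
        unfolding f_def by (simp only: power3_eq_cube power2_eq_square) (simp only: algebra_simps, simp)
    qed
    have "P (Suc N) = P N + fps_X ^ Suc (Suc N) * (h * P N)"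
      by (simp add: P_def h algebra_simps)
    then show ?thesis
      using that by (simp add: fps_X_power_mult_nth del: power_Suc)
  qed
  have stable: "fps_nth (P N) k = fps_nth (P k) k" if "k \<le> N" for k N
    using that by (induction N rule: dec_induct) (auto simp: step)
  have "P \<longlonglongrightarrow> p"
    by (rule tendsto_fpsI) (auto simp: p_def eventually_sequentially intro: stable)
  \<comment> \<open>\<open>raw_has_prod\<close> demands a nonzero limit.\<close>
  moreover have p0: "fps_nth p 0 = 1"
    by (simp add: p_def P_def f_def startsby_one_power)
  then have "p \<noteq> 0"
    by auto
  ultimately have "f has_prod p"
    by (simp add: has_prod_def raw_has_prod_def P_def)
  then have "eta_prod = p"
    unfolding eta_prod_def f_def[symmetric] by (metis has_prod_unique)
  with p0 show ?thesis
    by simp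
qed

section \<open>Comparison of the two closed forms\<close>

theorem theorem5p15:
  fixes M n :: "nat \<Rightarrow> rat poly"
  assumes M: "Abs_fps M =
      ((1 - fps_X)^2 * (1 - fps_X^2)) \<oslash> eta_prod
        * (fps_const ((xvar + 2) pchoose 2) - 3 * lambert_sum)"
    and n: "\<And>\<delta>. n \<delta> =
      (\<Sum>j=0..\<delta>. M j * ((xvar^2 - 3 * xvar + 3 - of_nat \<delta> - of_nat j) pchoose (\<delta> - j)))"
  defines "F \<equiv> (1 \<oslash> (binom_pow (- fps_X) (xvar^2 - 3 * xvar + 2) * (1 - fps_X^2))) * Abs_fps M"
    and "G \<equiv> (1 \<oslash> (binom_pow (- fps_X) (xvar^2 - 3 * xvar) * eta_prod))
               * (fps_const ((xvar + 2) pchoose 2) - 3 * lambert_sum)"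
  shows "fps_compose t_of_q q_of_t = fps_X \<and> fps_compose q_of_t t_of_q = fps_X
    \<and> fps_compose (Abs_fps n) t_of_q = F \<and> Abs_fps n = fps_compose F q_of_t
    \<and> fps_compose (Abs_fps n) t_of_q = G \<and> Abs_fps n = fps_compose G q_of_t"
proof -
  let ?e = "xvar^2 - 3 * xvar"
  let ?B = "binom_pow (- fps_X)"
  define R where "R = 1 \<oslash> (?B (?e + 2) * (1 - fps_X^2))"
  define H where "H = 1 \<oslash> (?B ?e * eta_prod)"
  define E where "E = ((1 - fps_X)^2 * (1 - fps_X^2)) \<oslash> eta_prod"
  have R: "R * (?B (?e + 2) * (1 - fps_X^2)) = 1"
    unfolding R_def by (rule fps_quot_mult_cancel) simp
  have H: "H * (?B ?e * eta_prod) = 1"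
    unfolding H_def by (rule fps_quot_mult_cancel) simp
  have E: "E * eta_prod = (1 - fps_X)^2 * (1 - fps_X^2)"
    unfolding E_def by (rule fps_quot_mult_cancel) simp
  have B_add: "?B (b + of_nat k) = ?B b * (1 - fps_X) ^ k" for b k
    by (simp add: binom_pow_add binom_pow_of_nat)
  have B3: "?B (?e + 3) = ?B (?e + 2) * (1 - fps_X)"
    using B_add[of "?e + 2" 1] by (simp add: add.assoc)
  have B2: "?B (?e + 2) = ?B ?e * (1 - fps_X)^2"
    using B_add[of ?e 2] by simp
  \<comment> \<open>The binomials in \<open>n\<close> have \<open>a = ?e + 3\<close>; one factor
    \<open>1 - fps_X\<close> moves over to complete \<open>1 - fps_X^2\<close>.\<close>
  have "?B (?e + 3) * (1 + fps_X) = ?B (?e + 2) * (1 - fps_X^2)"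
    unfolding B3 by (simp add: algebra_simps power2_eq_square)
  with R have "Abs_fps n oo t_of_q = R * Abs_fps M"
    using compose_t_of_q_mult[OF n, of R] by simp
  then have F: "Abs_fps n oo t_of_q = F"
    by (simp add: F_def R_def)
  \<comment> \<open>\<open>F\<close> and \<open>G\<close> share the factor with
    \<open>lambert_sum\<close>, so it remains to compare \<open>R * E\<close> with \<open>H\<close>,
    here after multiplying by a common denominator.\<close>
  have "(R * E) * (?B (?e + 2) * (1 - fps_X^2) * eta_prod)
      = (R * (?B (?e + 2) * (1 - fps_X^2))) * (E * eta_prod)"
    by (simp only: mult_ac)
  also have "\<dots> = (1 - fps_X)^2 * (1 - fps_X^2) * (H * (?B ?e * eta_prod))"
    by (simp only: R E H mult_1_left mult_1_right)
  also have "\<dots> = H * (?B (?e + 2) * (1 - fps_X^2) * eta_prod)"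
    by (simp only: B2 mult_ac)
  finally have "R * E = H"
  proof (rule mult_right_cancel[THEN iffD1, rotated])
    have "fps_nth (?B (?e + 2) * (1 - fps_X^2) * eta_prod) 0 = 1"
      by simp
    then show "?B (?e + 2) * (1 - fps_X^2) * eta_prod \<noteq> 0"
      by (metis fps_zero_nth zero_neq_one)
  qed
  then have "F = G"
    unfolding F_def G_def M R_def[symmetric] H_def[symmetric] E_def[symmetric]
    by (simp only: mult.assoc [symmetric])
  moreover have "Abs_fps n = F oo q_of_t"
    by (simp add: t_of_q_compose_q_of_t flip: F fps_compose_assoc)
  ultimately show ?thesis
    using F t_of_q_compose_q_of_t q_of_t_compose_t_of_q by simp
qed

end
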